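(* Let $\Sigma$ be a finite alphabet of non-negative integer letters containing the letter $0$, with $a=|\Sigma|\ge 2$. Let $1\le m<n$ be integers and write $n=km+r$ with $r=n\bmod m$, and assume $r\ne 0$. Put $m_1=r$, $n_1=(k+1)r$, $m_2=m-r$, $n_2=k(m-r)$, $N_1=a^{n_1}$, $N_2=a^{n_2}$. For $j=1,2$ let $\tau_j$ be an $m_j$-shift de Bruijn sequence of order $n_j$ over $\Sigma$ whose prefix of length $n_j$ is $0^{n_j}$, and let $w_j=\tau_j0^{m_j}$. Define $$u_i=w_1[n_1+(i-1)m_1+1\,..\,n_1+im_1]\quad(1\le i\le N_1),\qquad v_i=w_2[n_2+(i-1)m_2+1\,..\,n_2+im_2]\quad(1\le i\le N_2),$$ and, for $i\ge 1$, $$u'_i=u_{1+(i\bmod (N_1-1))},\qquad v'_i=v_{1+((i-1)\bmod N_2)}.$$ Then the word $$0^{n}\;v_10^{m_1}\;v_20^{m_1}\cdots v_{N_2-1}0^{m_1}\;v_{N_2}u'_{(N_1-1)N_2}\;v'_1u'_1\;v'_2u'_2\cdots v'_{(N_1-1)N_2-1}u'_{(N_1-1)N_2-1}$$ is an $m$-shift de Bruijn sequence of order $n$ over $\Sigma$.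
   Context: $\Sigma^n$ denotes the set of all words of length $n$ over $\Sigma$, juxtaposition denotes concatenation, and $0^t$ is the word consisting of $t$ zeros. For a word $w=a_1a_2\cdots a_\ell$, write $w[i..j]=a_i\cdots a_j$. A word $u$ of length $n$ appears in $w$ (as a factor) at a modulo $m$ position if $u=w[im+1..im+n]$ for some integer $i\ge 0$; distinct values of $i$ count as distinct appearances. An $m$-shift de Bruijn sequence of order $n$ over $\Sigma$ is a word $w$ over $\Sigma$, of length $m|\Sigma|^n+(n-m)$, such that each word in $\Sigma^n$ appears exactly once in $w$ as a factor at a modulo $m$ position. *)

theory Defs
  imports Main
begin

text \<open>
  Words are lists. Positions in a word are counted from 1, so
  \<open>factor w i j\<close> is \<open>w[i..j]\<close> for \<open>1 \<le> i\<close> and \<open>j \<le> length w\<close>.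
\<close>

definition factor :: "'a list \<Rightarrow> nat \<Rightarrow> nat \<Rightarrow> 'a list" where
  "factor w i j = take (Suc j - i) (drop (i - 1) w)"

definition words_of_length :: "'a set \<Rightarrow> nat \<Rightarrow> 'a list set" where
  "words_of_length A n = {u. set u \<subseteq> A \<and> length u = n}"

definition appears_at :: "nat \<Rightarrow> 'a list \<Rightarrow> 'a list \<Rightarrow> nat \<Rightarrow> bool" where
  "appears_at m u w i \<longleftrightarrow>
     i * m + length u \<le> length w \<and> u = factor w (i * m + 1) (i * m + length u)"

text \<open>
  The order \<open>n\<close> may be smaller than \<open>m\<close>; the length \<open>m |A|\<^sup>n + (n - m)\<close> is therefore
  written with the subtraction last, where it does not truncate for nonempty finite \<open>A\<close>.
\<close>

definition shift_de_Bruijn :: "nat \<Rightarrow> nat \<Rightarrow> 'a set \<Rightarrow> 'a list \<Rightarrow> bool" where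
  "shift_de_Bruijn m n A w \<longleftrightarrow>
     set w \<subseteq> A \<and> length w = m * card A ^ n + n - m \<and>
     (\<forall>u \<in> words_of_length A n. \<exists>!i. appears_at m u w i)"

end

theory Submission
  imports Defs
begin

text \<open>
  Cut the result into alternating blocks of lengths \<open>m1\<close> and \<open>m2\<close>. The window at \<open>i * m\<close> interleaves
  \<open>k + 1\<close> consecutive blocks of the first kind with \<open>k\<close> of the second kind. The second kind runs
  periodically through the cycle of \<open>\<tau>2\<close> and determines \<open>i mod N2\<close>. The first kind is zero for the
  first \<open>N2\<close> windows; from then on it runs through the cycle of \<open>\<tau>1\<close> with one zero block deleted, so
  it is a nonzero word that determines \<open>i - N2\<close> modulo \<open>N1 - 1\<close>. As \<open>N1 - 1\<close> and \<open>N2\<close> are coprime, the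
  \<open>N1 * N2\<close> windows are distinct, and hence exhaust the words of length \<open>n\<close>.
\<close>

section \<open>Windows at multiples of \<open>m\<close>\<close>

lemma factor_eq_take_drop: "factor w (p + 1) (p + l) = take l (drop p w)"
  by (simp add: factor_def)

lemma card_words_of_length: "finite A \<Longrightarrow> card (words_of_length A n) = card A ^ n"
  by (simp add: words_of_length_def card_lists_length_eq)

lemma finite_words_of_length: "finite A \<Longrightarrow> finite (words_of_length A n)"
  by (simp add: words_of_length_def finite_lists_length_eq)

lemma appears_at_iff:
  assumes "m \<ge> 1" and "N \<ge> 1" and "length w = m * N + n - m" and "length u = n"
  shows "appears_at m u w i \<longleftrightarrow> i < N \<and> take n (drop (i * m) w) = u"
proof -
  have "i * m + n \<le> m * N + n - m \<longleftrightarrow> (i + 1) * m \<le> N * m"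
    using assms(2) by (cases N) (auto simp: algebra_simps)
  also have "\<dots> \<longleftrightarrow> i < N"
    using assms(1) by (subst mult_le_cancel2) auto
  finally show ?thesis
    using assms by (auto simp: appears_at_def factor_eq_take_drop[simplified])
qed

lemma window_in_words_of_length:
  assumes "set w \<subseteq> A" and "length w = m * N + n - m" and "i < N"
  shows "take n (drop (i * m) w) \<in> words_of_length A n"
proof -
  have "(i + 1) * m \<le> N * m"
    using assms(3) by (intro mult_le_mono1) simp
  then have "i * m + n \<le> m * N + n - m"
    by (simp add: algebra_simps)
  then show ?thesis
    using assms(1,2) set_take_subset set_drop_subset
    by (fastforce simp: words_of_length_def)
qed

text \<open>The prescribed length leaves room for exactly \<open>card A ^ n\<close> window starts,
  so existence and uniqueness of the appearance become surjectivity and injectivity of the window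
  map.\<close>

lemma shift_de_Bruijn_iff_bij_betw:
  assumes "finite A" and "A \<noteq> {}" and "m \<ge> 1"
  shows "shift_de_Bruijn m n A w \<longleftrightarrow>
    set w \<subseteq> A \<and> length w = m * card A ^ n + n - m \<and>
    bij_betw (\<lambda>i. take n (drop (i * m) w)) {..<card A ^ n} (words_of_length A n)"
    (is "_ \<longleftrightarrow> ?S \<and> ?L \<and> bij_betw ?g ?I ?W")
proof (cases "?S \<and> ?L")
  case True
  have N: "card A ^ n \<ge> 1"
    using assms(1,2) by (simp add: Suc_le_eq card_gt_0_iff)
  have mem: "?g i \<in> ?W" if "i < card A ^ n" for i
    using window_in_words_of_length[of w A m _ n i] True that by blast
  have app: "appears_at m u w i \<longleftrightarrow> i \<in> ?I \<and> ?g i = u" if "u \<in> ?W" for u i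
    using appears_at_iff[OF assms(3) N, of w n u i] True that
    by (simp add: words_of_length_def)
  have "(\<forall>u\<in>?W. \<exists>!i. appears_at m u w i) \<longleftrightarrow> (\<forall>u\<in>?W. \<exists>!i. i \<in> ?I \<and> ?g i = u)"
    using app by simp
  also have "\<dots> \<longleftrightarrow> bij_betw ?g ?I ?W"
  proof
    assume ex: "\<forall>u\<in>?W. \<exists>!i. i \<in> ?I \<and> ?g i = u"
    have "inj_on ?g ?I"
      by (rule inj_onI) (use ex mem in \<open>metis lessThan_iff\<close>)
    moreover have "?g ` ?I = ?W"
      using ex mem by (auto simp: image_iff)
    ultimately show "bij_betw ?g ?I ?W"
      by (simp add: bij_betw_def)
  next
    assume "bij_betw ?g ?I ?W"
    then show "\<forall>u\<in>?W. \<exists>!i. i \<in> ?I \<and> ?g i = u"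
      by (auto simp: bij_betw_iff_bijections) (metis lessThan_iff)+
  qed
  finally show ?thesis
    using True by (simp add: shift_de_Bruijn_def)
qed (auto simp: shift_de_Bruijn_def)

text \<open>There are as many windows as words of length \<open>n\<close>, so injectivity forces
  surjectivity. No appearance of a given word has to be constructed.\<close>

lemma shift_de_Bruijn_if_inj_on:
  assumes "finite A" and "A \<noteq> {}" and "m \<ge> 1"
    and "set w \<subseteq> A" and "length w = m * card A ^ n + n - m"
    and inj: "inj_on (\<lambda>i. take n (drop (i * m) w)) {..<card A ^ n}" (is "inj_on ?g ?I")
  shows "shift_de_Bruijn m n A w"
proof -
  have "?g ` ?I = words_of_length A n"
  proof (rule card_subset_eq)
    show "?g ` ?I \<subseteq> words_of_length A n"
      using window_in_words_of_length[OF assms(4,5)] by auto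
    show "card (?g ` ?I) = card (words_of_length A n)"
      using card_image[OF inj] assms(1) by (simp add: card_words_of_length)
  qed (use assms(1) in \<open>rule finite_words_of_length\<close>)
  then show ?thesis
    using assms by (simp add: shift_de_Bruijn_iff_bij_betw bij_betw_def)
qed

section \<open>Closing a shift de Bruijn sequence into a cycle\<close>

text \<open>A further rotation by \<open>n - m mod n\<close> completes full turns, which supplies
  preimages. The bijection serves to exchange prefixes and suffixes when all words are
  counted.\<close>

lemma bij_betw_rotate_words_of_length:
  "bij_betw (rotate m) (words_of_length A n) (words_of_length A n)"
  unfolding bij_betw_def
proof
  show "inj_on (rotate m) (words_of_length A n)"
    by (auto intro!: inj_onI simp: words_of_length_def rotate_drop_take)
       (metis append_take_drop_id)
  show "rotate m ` words_of_length A n = words_of_length A n"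
  proof (intro equalityI subsetI)
    fix u assume u: "u \<in> words_of_length A n"
    show "u \<in> rotate m ` words_of_length A n"
    proof (rule image_eqI)
      have "(n - m mod n + m) mod n = 0" if "n > 0"
        using that by (metis mod_add_right_eq le_add_diff_inverse2
            mod_less_divisor less_imp_le mod_self)
      then show "u = rotate m (rotate (n - m mod n) u)"
        using u by (cases "n = 0") (auto simp: words_of_length_def rotate_rotate add.commute)
      show "rotate (n - m mod n) u \<in> words_of_length A n"
        using u by (simp add: words_of_length_def)
    qed
  qed (auto simp: words_of_length_def)
qed

text \<open>
  Every word of length \<open>n - m\<close> is as often a prefix as a suffix of a word of length \<open>n\<close>, because
  rotation by \<open>m\<close> turns suffixes into prefixes. The windows of length \<open>n - m\<close> of the sequence
  therefore form a closed Eulerian walk.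
\<close>

lemma shift_de_Bruijn_wraps:
  assumes "finite A" and "A \<noteq> {}" and "m \<ge> 1" and "m \<le> n"
    and dB: "shift_de_Bruijn m n A w"
  shows "drop (m * card A ^ n) w = take (n - m) w"
proof -
  define N where "N = card A ^ n"
  define g where "g i = take n (drop (i * m) w)" for i
  define p where "p i = take (n - m) (drop (i * m) w)" for i
  \<comment> \<open>Indicator of the starting vertex of the walk; its sums count visits to that
    vertex.\<close>
  define f where "f u = (if u = p 0 then 1 else 0 :: nat)" for u
  have len: "length w = m * N + (n - m)"
    using assms(4) dB by (simp add: shift_de_Bruijn_def N_def)
  have bij: "bij_betw g {..<N} (words_of_length A n)"
    using dB assms by (simp add: shift_de_Bruijn_iff_bij_betw N_def g_def[abs_def])
  have drop_g: "drop m (g i) = p (Suc i)" for i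
    by (simp add: g_def p_def drop_take add.commute)
  have take_g: "take (n - m) (g i) = p i" for i
    using assms(4) by (simp add: g_def p_def min_def)
  have rot: "take (n - m) (rotate m u) = drop m u" if "u \<in> words_of_length A n" for u
    using that assms(3,4)
    by (cases "m = n") (auto simp: words_of_length_def rotate_drop_take)
  have "(\<Sum>i<N. f (p i)) = (\<Sum>u\<in>words_of_length A n. f (take (n - m) u))"
    using sum.reindex_bij_betw[OF bij, of "\<lambda>u. f (take (n - m) u)"] by (simp add: take_g)
  also have "\<dots> = (\<Sum>u\<in>words_of_length A n. f (take (n - m) (rotate m u)))"
    by (rule sum.reindex_bij_betw[OF bij_betw_rotate_words_of_length, symmetric])
  also have "\<dots> = (\<Sum>u\<in>words_of_length A n. f (drop m u))"
    by (simp add: rot)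
  also have "\<dots> = (\<Sum>i<N. f (p (Suc i)))"
    using sum.reindex_bij_betw[OF bij, of "\<lambda>u. f (drop m u)"] by (simp add: drop_g)
  \<comment> \<open>Departures from \<open>p 0\<close> balance arrivals. The two sums share all but
    their end terms, so \<open>f (p N) = f (p 0) = 1\<close>.\<close>
  finally have "f (p 0) + (\<Sum>i<N. f (p i)) = (\<Sum>i<N. f (p i)) + f (p N)"
    using sum.lessThan_Suc_shift[of "\<lambda>i. f (p i)" N] sum.lessThan_Suc[of "\<lambda>i. f (p i)" N] by simp
  then have "p N = p 0"
    by (simp add: f_def split: if_splits)
  moreover have "p N = drop (m * N) w"
    using len by (simp add: p_def mult.commute)
  ultimately show ?thesis
    by (simp add: p_def N_def)
qed

text \<open>Since \<open>w\<close> wraps around, it is a prefix of the periodic word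
  \<open>s\<close> that repeats its first \<open>m * card A ^ n\<close> letters. The appended
  letters \<open>z\<close> continue \<open>s\<close> because the period begins with \<open>n\<close>
  of them. Working with \<open>s\<close> removes index bounds and makes windows comparable modulo
  \<open>card A ^ n\<close>.\<close>

lemma obtain_cyclic_extension:
  assumes "finite A" and "z \<in> A" and "card A \<ge> 2" and "m \<ge> 1" and "m \<le> n"
    and dB: "shift_de_Bruijn m n A w" and prefix: "take n w = replicate n z"
  obtains s where
    "\<forall>p<m * card A ^ n + n. (w @ replicate m z) ! p = s p"
    "\<forall>p. s (p + m * card A ^ n) = s p"
    "\<forall>p. s p \<in> A"
    "\<forall>p<n. s p = z"
    "\<forall>i j. (\<forall>c<n. s (i * m + c) = s (j * m + c)) \<longrightarrow> i mod card A ^ n = j mod card A ^ n"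
proof -
  define N where "N = card A ^ n"
  define s where "s p = w ! (p mod (m * N))" for p
  \<comment> \<open>Ensures that the initial run of \<open>z\<close> lies within one period.\<close>
  have "n < N"
    using less_le_trans[OF less_exp power_mono[OF assms(3)]] by (simp add: N_def)
  then have N: "N > 0" "n < m * N" "m * N > 0"
    using assms(4) by (auto intro: less_le_trans)
  have sub: "set w \<subseteq> A" and len: "length w = m * N + (n - m)"
    using assms(5) dB by (simp_all add: shift_de_Bruijn_def N_def)
  have z: "w ! p = z" if "p < n" for p
    using that prefix by (metis nth_replicate nth_take)
  have wrap: "drop (m * N) w = take (n - m) w"
    unfolding N_def by (rule shift_de_Bruijn_wraps[OF assms(1) _ assms(4,5) dB]) (use assms(2) in auto)
  \<comment> \<open>Past \<open>m * N\<close> the first \<open>n - m\<close> letters are still in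
    \<open>w\<close> and equal its prefix by \<open>wrap\<close>; the last \<open>m\<close> are the
    appended ones. All of them are \<open>z\<close>.\<close>
  have ext: "(w @ replicate m z) ! p = s p" if "p < m * N + n" for p
  proof (cases "p < m * N")
    case True
    then show ?thesis
      using len by (simp add: s_def nth_append)
  next
    case False
    then obtain q where q: "p = m * N + q"
      by (metis le_add_diff_inverse not_less)
    with that have qn: "q < n"
      by simp
    have "s p = z"
      using qn N z by (simp add: s_def q)
    moreover have "w ! p = z" if "q < n - m"
    proof -
      have "w ! p = drop (m * N) w ! q"
        using len by (simp add: q)
      also have "\<dots> = z"
        using that z by (simp add: wrap)
      finally show ?thesis .
    qed
    ultimately show ?thesis
      using len qn assms(5) by (auto simp: nth_append q)
  qed
  have period: "s (p + m * N) = s p" for p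
    by (simp add: s_def)
  have shift: "s (i * m + c) = s ((i mod N) * m + c)" for i c
  proof -
    have "(i * m + c) mod (m * N) = ((i mod N) * m + c) mod (m * N)"
      by (metis mod_add_left_eq mult.commute mult_mod_right)
    then show ?thesis
      by (simp add: s_def)
  qed
  have window: "take n (drop (i * m) w) = map (\<lambda>c. s (i * m + c)) [0..<n]" if "i < N" for i
  proof (rule nth_equalityI)
    have "(i + 1) * m \<le> N * m"
      using that by (intro mult_le_mono1) simp
    then have le: "i * m + m \<le> m * N"
      by (simp add: algebra_simps)
    then show len': "length (take n (drop (i * m) w)) = length (map (\<lambda>c. s (i * m + c)) [0..<n])"
      using len assms(5) by simp
    fix c assume "c < length (take n (drop (i * m) w))"
    then have c: "c < n" "i * m + c < length w"
      by auto
    then show "take n (drop (i * m) w) ! c = map (\<lambda>c. s (i * m + c)) [0..<n] ! c"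
      using ext[of "i * m + c"] len by (simp add: nth_append)
  qed
  have "bij_betw (\<lambda>i. take n (drop (i * m) w)) {..<N} (words_of_length A n)"
    unfolding N_def
    using dB assms(1,2,4) by (subst (asm) shift_de_Bruijn_iff_bij_betw) auto
  then have inj: "inj_on (\<lambda>i. take n (drop (i * m) w)) {..<N}"
    by (rule bij_betw_imp_inj_on)
  show thesis
  proof (rule that[of s, folded N_def])
    show "\<forall>p. s p \<in> A"
      using sub len N nth_mem[of "p mod (m * N)" w for p] by (auto simp: s_def trans_less_add1)
    show "\<forall>p<n. s p = z"
      using z N by (simp add: s_def)
    show "\<forall>i j. (\<forall>c<n. s (i * m + c) = s (j * m + c)) \<longrightarrow> i mod N = j mod N"
    proof (intro allI impI)
      fix i j assume "\<forall>c<n. s (i * m + c) = s (j * m + c)"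
      then have "take n (drop (i mod N * m) w) = take n (drop (j mod N * m) w)"
        using N by (simp add: window shift[symmetric])
      then show "i mod N = j mod N"
        by (rule inj_onD[OF inj]) (use N in auto)
    qed
  qed (use ext period in auto)
qed

section \<open>Segments of an infinite word, and residues\<close>

lemma concat_map_eq_map_upt:
  assumes "a \<le> b" and "\<And>i. a \<le> i \<Longrightarrow> i < b \<Longrightarrow> g i = map q [c + i * m..<c + Suc i * m]"
  shows "concat (map g [a..<b]) = map q [c + a * m..<c + b * m]"
  using assms
proof (induction b rule: dec_induct)
  case (step b)
  have "[c + a * m..<c + Suc b * m] = [c + a * m..<c + b * m] @ [c + b * m..<c + Suc b * m]"
    using step.hyps upt_add_eq_append[of "c + a * m" "c + b * m" m] by (simp add: add.commute add.left_commute)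
  with step show ?case
    by simp
qed simp

lemma take_drop_map_upt:
  assumes "p + l \<le> N"
  shows "take l (drop p (map q [0..<N])) = map (\<lambda>c. q (p + c)) [0..<l]"
  by (rule nth_equalityI) (use assms in auto)

text \<open>The uniqueness half of the Chinese remainder theorem, obtained from divisibility of the
  difference.\<close>

lemma mod_mult_eqI:
  fixes i j M N :: nat
  assumes "coprime M N" and "i mod M = j mod M" and "i mod N = j mod N"
  shows "i mod (M * N) = j mod (M * N)"
  using assms
proof (induction i j rule: linorder_wlog)
  case (le i j)
  then have "M dvd j - i" "N dvd j - i"
    by (metis mod_eq_dvd_iff_nat)+
  with le have "M * N dvd j - i"
    by (simp add: divides_mult)
  with le show ?case
    by (metis mod_eq_dvd_iff_nat)
next
  case (sym i j)
  then show ?case by simp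
qed

theorem mainTheorem3:
  fixes A :: "nat set"
    and a m n k r m1 n1 m2 n2 N1 N2 :: nat
    and \<tau>1 \<tau>2 w1 w2 :: "nat list"
    and u v u' v' :: "nat \<Rightarrow> nat list"
  assumes "finite A" and "0 \<in> A" and "a = card A" and "a \<ge> 2"
    and "1 \<le> m" and "m < n"
    and "n = k * m + r" and "r = n mod m" and "r \<noteq> 0"
    and "m1 = r" and "n1 = (k + 1) * r"
    and "m2 = m - r" and "n2 = k * (m - r)"
    and "N1 = a ^ n1" and "N2 = a ^ n2"
    and "shift_de_Bruijn m1 n1 A \<tau>1" and "take n1 \<tau>1 = replicate n1 0"
    and "shift_de_Bruijn m2 n2 A \<tau>2" and "take n2 \<tau>2 = replicate n2 0"
    and "w1 = \<tau>1 @ replicate m1 0" and "w2 = \<tau>2 @ replicate m2 0"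
    and "\<And>i. 1 \<le> i \<Longrightarrow> i \<le> N1 \<Longrightarrow> u i = factor w1 (n1 + (i - 1) * m1 + 1) (n1 + i * m1)"
    and "\<And>i. 1 \<le> i \<Longrightarrow> i \<le> N2 \<Longrightarrow> v i = factor w2 (n2 + (i - 1) * m2 + 1) (n2 + i * m2)"
    and "\<And>i. 1 \<le> i \<Longrightarrow> u' i = u (1 + i mod (N1 - 1))"
    and "\<And>i. 1 \<le> i \<Longrightarrow> v' i = v (1 + (i - 1) mod N2)"
  shows "shift_de_Bruijn m n A
    (replicate n 0
     @ concat (map (\<lambda>i. v i @ replicate m1 0) [1..<N2])
     @ v N2 @ u' ((N1 - 1) * N2)
     @ concat (map (\<lambda>i. v' i @ u' i) [1..<(N1 - 1) * N2]))"
proof -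
  note zero = \<open>0 \<in> A\<close> and a = \<open>a = card A\<close> and a2 = \<open>a \<ge> 2\<close>
  note m1 = \<open>m1 = r\<close> and n1 = \<open>n1 = (k + 1) * r\<close>
    and m2 = \<open>m2 = m - r\<close> and n2 = \<open>n2 = k * (m - r)\<close>
  note N1 = \<open>N1 = a ^ n1\<close> and N2 = \<open>N2 = a ^ n2\<close>
  have r: "0 < r" "r < m"
    using \<open>1 \<le> m\<close> \<open>r = n mod m\<close> \<open>r \<noteq> 0\<close> by auto
  have k: "k \<ge> 1"
    using \<open>m < n\<close> \<open>n = k * m + r\<close> r(2) by (cases k) auto
  have m: "m1 + m2 = m" "m1 \<ge> 1" "m2 \<ge> 1"
    using r by (simp_all add: m1 m2)
  have n_eq: "n = k * m + m1"
    by (simp add: \<open>n = k * m + r\<close> m1)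
  have n1_eq: "n1 = (k + 1) * m1" and n2_eq: "n2 = k * m2"
    by (simp_all add: n1 n2 m1 m2)
  have n_split: "n = n1 + n2"
    by (simp add: n_eq n1_eq n2_eq m(1)[symmetric] algebra_simps)
  have le: "m1 \<le> n1" "m2 \<le> n2"
    using k by (simp_all add: n1_eq n2_eq)
  \<comment> \<open>The bound \<open>k + 1 < N1\<close> makes the \<open>k + 1\<close> blocks of a
    window fit into the cycle that remains after one block is deleted.\<close>
  have "k + 1 \<le> n1"
    using mult_le_mono2[OF m(2), of "k + 1"] by (simp add: n1_eq)
  also have "n1 < 2 ^ n1"
    by (rule less_exp)
  also have "2 ^ n1 \<le> N1"
    using a2 by (simp add: N1 power_mono)
  finally have kN1: "k + 1 < N1" .
  have "n2 \<ge> 1"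
    using le(2) m(3) by simp
  then have N2_ge: "N2 \<ge> 2"
    using a2 power_increasing[of 1 n2 a] by (simp add: N2)
  \<comment> \<open>\<open>M\<close> is the number of blocks in the first cycle after the deletion,
    and \<open>L\<close> below the number of windows that remain after the first
    \<open>N2\<close>.\<close>
  define M where "M = N1 - 1"
  have M: "N1 = M + 1" "k < M" "M \<ge> 1"
    using kN1 by (auto simp: M_def)
  define L where "L = M * N2"
  have L: "L \<ge> 1" "N2 + L = N1 * N2"
    using M(3) N2_ge by (simp_all add: L_def M(1))
  have card2: "card A \<ge> 2"
    using a a2 by simp

  \<comment> \<open>The two cyclic words and their blocks\<close>
  obtain s1 where s1: "\<forall>p<m1 * N1 + n1. w1 ! p = s1 p"
    and s1_period: "\<forall>p. s1 (p + m1 * N1) = s1 p"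
    and s1_in: "\<forall>p. s1 p \<in> A" and s1_zero: "\<forall>p<n1. s1 p = 0"
    and s1_inj: "\<forall>i j. (\<forall>c<n1. s1 (i * m1 + c) = s1 (j * m1 + c)) \<longrightarrow> i mod N1 = j mod N1"
    by (rule obtain_cyclic_extension[OF \<open>finite A\<close> zero card2 m(2) le(1)
          \<open>shift_de_Bruijn m1 n1 A \<tau>1\<close> \<open>take n1 \<tau>1 = replicate n1 0\<close>,
          folded a, folded N1 \<open>w1 = \<tau>1 @ replicate m1 0\<close>])
  obtain s2 where s2: "\<forall>p<m2 * N2 + n2. w2 ! p = s2 p"
    and s2_period: "\<forall>p. s2 (p + m2 * N2) = s2 p"
    and s2_in: "\<forall>p. s2 p \<in> A" and s2_zero: "\<forall>p<n2. s2 p = 0"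
    and s2_inj: "\<forall>i j. (\<forall>c<n2. s2 (i * m2 + c) = s2 (j * m2 + c)) \<longrightarrow> i mod N2 = j mod N2"
    by (rule obtain_cyclic_extension[OF \<open>finite A\<close> zero card2 m(3) le(2)
          \<open>shift_de_Bruijn m2 n2 A \<tau>2\<close> \<open>take n2 \<tau>2 = replicate n2 0\<close>,
          folded a, folded N2 \<open>w2 = \<tau>2 @ replicate m2 0\<close>])
  have len_w1: "length w1 = m1 * N1 + n1"
    using \<open>shift_de_Bruijn m1 n1 A \<tau>1\<close> le(1)
    by (simp add: shift_de_Bruijn_def N1 a \<open>w1 = \<tau>1 @ replicate m1 0\<close>)
  have len_w2: "length w2 = m2 * N2 + n2"
    using \<open>shift_de_Bruijn m2 n2 A \<tau>2\<close> le(2)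
    by (simp add: shift_de_Bruijn_def N2 a \<open>w2 = \<tau>2 @ replicate m2 0\<close>)

  have u_map: "u (Suc i) = map (\<lambda>t. s1 (n1 + i * m1 + t)) [0..<m1]" if "i < N1" for i
  proof -
    have "Suc i * m1 \<le> N1 * m1"
      using that by (intro mult_le_mono1) simp
    then have le': "n1 + i * m1 + m1 \<le> m1 * N1 + n1"
      by (simp add: algebra_simps)
    have "u (Suc i) = take m1 (drop (n1 + i * m1) w1)"
      using that assms(22)[of "Suc i"] by (simp add: factor_def algebra_simps)
    also have "\<dots> = map (\<lambda>t. s1 (n1 + i * m1 + t)) [0..<m1]"
      by (rule nth_equalityI) (use that le' len_w1 in \<open>auto simp: s1\<close>)
    finally show ?thesis .
  qed
  have v_map: "v (Suc i) = map (\<lambda>t. s2 (n2 + i * m2 + t)) [0..<m2]" if "i < N2" for i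
  proof -
    have "Suc i * m2 \<le> N2 * m2"
      using that by (intro mult_le_mono1) simp
    then have le': "n2 + i * m2 + m2 \<le> m2 * N2 + n2"
      by (simp add: algebra_simps)
    have "v (Suc i) = take m2 (drop (n2 + i * m2) w2)"
      using that assms(23)[of "Suc i"] by (simp add: factor_def algebra_simps)
    also have "\<dots> = map (\<lambda>t. s2 (n2 + i * m2 + t)) [0..<m2]"
      by (rule nth_equalityI) (use that le' len_w2 in \<open>auto simp: s2\<close>)
    finally show ?thesis .
  qed

  \<comment> \<open>The interleaved infinite word\<close>
  \<comment> \<open>Block \<open>i\<close> of the first kind. After the zero phase it runs through
    the blocks \<open>k + 1\<close> to \<open>k + M\<close> of \<open>s1\<close>; the block
    \<open>k + N1\<close>, a copy of the zero block \<open>k\<close>, is the deleted one. Blocks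
    \<open>y\<close> follow the cycle of \<open>s2\<close> unchanged, and \<open>q\<close>
    alternates the two kinds.\<close>
  define x where "x i t = (if i < k + N2 then 0 else s1 (n1 + (i - (k + N2)) mod M * m1 + t))" for i t
  define y where "y i t = s2 (i * m2 + t)" for i t
  define q where "q p = (if p mod m < m1 then x (p div m) (p mod m) else y (p div m) (p mod m - m1))" for p
  have q_x: "q (i * m + t) = x i t" if "t < m1" for i t
    using that m by (simp add: q_def)
  have q_y: "q (i * m + m1 + t) = y i t" if "t < m2" for i t
  proof -
    have "(i * m + m1 + t) div m = i" "(i * m + m1 + t) mod m = m1 + t"
      using that m div_mult_self3[of m "m1 + t" i]
      by (simp_all add: add.assoc)
    then show ?thesis
      by (simp add: q_def)
  qed

  \<comment> \<open>The words \<open>v i\<close> start behind the \<open>k\<close> zero blocks of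
    \<open>s2\<close>, hence the shift by \<open>k\<close>; reduction modulo \<open>N2\<close>
    removes whole periods.\<close>
  have s2_mod: "s2 (n2 + i mod N2 * m2 + t) = y (k + i) t" for i t
  proof -
    have periods: "s2 (p + c * (m2 * N2)) = s2 p" for p c
    proof (induction c)
      case (Suc c)
      then show ?case
        using s2_period[rule_format, of "p + c * (m2 * N2)"] by (simp add: algebra_simps)
    qed simp
    have "(k + i) * m2 + t = (k + (i mod N2 + N2 * (i div N2))) * m2 + t"
      by simp
    also have "\<dots> = k * m2 + i mod N2 * m2 + t + i div N2 * (m2 * N2)"
      by (simp only: algebra_simps)
    finally show ?thesis
      by (simp only: y_def n2_eq periods)
  qed
  have v'_map: "v' (Suc i) = map (y (k + i)) [0..<m2]" for i
    using v_map[of "i mod N2"] N2_ge assms(25)[of "Suc i"] by (simp add: s2_mod)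
  have u'_map: "u' i = map (x (k + N2 + i)) [0..<m1]" if "i \<ge> 1" for i
  proof -
    have "i mod M < N1"
      using M(1,3) mod_less_divisor[of M i] by linarith
    moreover have "u' i = u (Suc (i mod M))"
      using that assms(24)[of i] by (simp add: M_def)
    ultimately show ?thesis
      using u_map[of "i mod M"] by (simp add: x_def)
  qed

  \<comment> \<open>The prefix of \<open>n = k * m + m1\<close> zeros ends with a block of the first
    kind, so each later piece of length \<open>m\<close> starts with one of the second kind. The
    offset \<open>n - m\<close> fits indices counted from 1.\<close>
  have q_block: "map q [n - m + Suc i * m..<n - m + Suc (Suc i) * m] =
      map (y (k + i)) [0..<m2] @ map (x (k + Suc i)) [0..<m1]" for i
  proof -
    have start: "n - m + Suc i * m = (k + i) * m + m1"
      using k by (cases k) (simp_all add: n_eq algebra_simps)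
    show ?thesis
    proof (rule nth_equalityI)
      fix c assume "c < length (map q [n - m + Suc i * m..<n - m + Suc (Suc i) * m])"
      then have c: "c < m"
        by simp
      have "map q [n - m + Suc i * m..<n - m + Suc (Suc i) * m] ! c = q (n - m + Suc i * m + c)"
        using c by simp
      also have "\<dots> = q ((k + i) * m + m1 + c)"
        by (simp only: start)
      also have "\<dots> = (map (y (k + i)) [0..<m2] @ map (x (k + Suc i)) [0..<m1]) ! c"
      proof (cases "c < m2")
        case True
        then show ?thesis
          by (simp add: q_y nth_append)
      next
        case False
        then have "(k + i) * m + m1 + c = (k + Suc i) * m + (c - m2)"
          using m(1) by simp
        with False c m(1) show ?thesis
          by (simp only: q_x) (simp add: nth_append)
      qed
      finally show "map q [n - m + Suc i * m..<n - m + Suc (Suc i) * m] ! c =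
        (map (y (k + i)) [0..<m2] @ map (x (k + Suc i)) [0..<m1]) ! c" .
    qed (use m in simp)
  qed

  \<comment> \<open>Identification of the constructed word with a prefix of \<open>q\<close>\<close>
  define W where "W = replicate n 0
     @ concat (map (\<lambda>i. v i @ replicate m1 0) [1..<N2])
     @ v N2 @ u' L
     @ concat (map (\<lambda>i. v' i @ u' i) [1..<L])"
  have W: "W = map q [0..<n - m + (N2 + L) * m]"
  proof -
    have v_eq: "v i = v' i" if "1 \<le> i" "i \<le> N2" for i
      using that assms(25)[of i] by simp
    \<comment> \<open>This range covers the blocks \<open>x 0\<close> to \<open>x k\<close> and
      \<open>y 0\<close> to \<open>y (k - 1)\<close>; the former lie in the zero phase, the latter
      in the zero prefix of \<open>s2\<close>.\<close>
    have "map q [0..<n] = replicate n 0"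
    proof (rule nth_equalityI)
      fix p assume "p < length (map q [0..<n])"
      then have p: "p < n"
        by simp
      have p_eq: "p = p div m * m + p mod m"
        by simp
      have "q p = 0"
      proof (cases "p mod m < m1")
        case True
        have "p div m \<le> n div m"
          using p by (intro div_le_mono) simp
        also have "n div m = k"
          using m by (simp add: n_eq)
        finally show ?thesis
          using True N2_ge by (simp add: q_def x_def)
      next
        case False
        have "p div m < k"
        proof (rule ccontr)
          assume "\<not> p div m < k"
          then have "k * m \<le> p div m * m"
            by (intro mult_le_mono1) simp
          with p_eq p False n_eq show False
            by linarith
        qed
        then have "Suc (p div m) * m2 \<le> k * m2"
          by (intro mult_le_mono1) simp
        moreover have "p mod m - m1 < m2"
          using False m mod_less_divisor[of m p] by linarith
        ultimately show ?thesis
          using False by (simp add: q_def y_def s2_zero n2_eq)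
      qed
      then show "map q [0..<n] ! p = replicate n 0 ! p"
        using p by simp
    qed simp
    moreover have "concat (map (\<lambda>i. v i @ replicate m1 0) [1..<N2]) =
        map q [n - m + 1 * m..<n - m + N2 * m]"
    proof (rule concat_map_eq_map_upt)
      fix i assume "1 \<le> i" "i < N2"
      then obtain j where i: "i = Suc j" "Suc j < N2"
        by (cases i) auto
      have "map (x (k + Suc j)) [0..<m1] = replicate m1 0"
        by (rule nth_equalityI) (use i(2) in \<open>simp_all add: x_def\<close>)
      moreover have "v (Suc j) = v' (Suc j)"
        using i(2) by (intro v_eq) simp_all
      ultimately show "v i @ replicate m1 0 = map q [n - m + i * m..<n - m + Suc i * m]"
        by (simp only: i(1) q_block v'_map)
    qed (use N2_ge in simp)
    moreover have "v N2 @ u' L @ zs = map q [n - m + N2 * m..<n - m + Suc N2 * m] @ zs" for zs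
    proof -
      obtain j where j: "N2 = Suc j"
        using N2_ge by (cases N2) auto
      \<comment> \<open>\<open>L\<close> is a multiple of \<open>M\<close>, so \<open>u' L\<close>
        is the block that starts the cycle, as needed directly after the zero phase.\<close>
      have "x (k + N2 + L) = x (k + N2)"
        by (rule ext) (simp add: x_def L_def)
      then show ?thesis
        using q_block[of j] v_eq[of N2] v'_map[of j] u'_map[OF L(1)] by (simp add: j)
    qed
    moreover have "concat (map (\<lambda>i. v' i @ u' i) [1..<L]) =
        map q [n - m + N2 * m + 1 * m..<n - m + N2 * m + L * m]"
    proof (rule concat_map_eq_map_upt)
      fix i assume "1 \<le> i" "i < L"
      then obtain j where i: "i = Suc j"
        by (cases i) auto
      \<comment> \<open>The tail restarts at \<open>v' 1\<close> but sits \<open>N2\<close> pieces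
        further on: exactly one period of the second kind.\<close>
      have "y (k + (N2 + j)) = y (k + j)"
        by (rule ext) (simp flip: s2_mod)
      then show "v' i @ u' i = map q [n - m + N2 * m + i * m..<n - m + N2 * m + Suc i * m]"
        using q_block[of "N2 + j"] u'_map[of "Suc j"] v'_map[of j]
        by (simp add: i algebra_simps)
    qed (rule L(1))
    moreover have "map q [0..<n - m + (N2 + L) * m] = map q [0..<n] @
        map q [n - m + 1 * m..<n - m + N2 * m] @
        map q [n - m + N2 * m..<n - m + Suc N2 * m] @
        map q [n - m + N2 * m + 1 * m..<n - m + N2 * m + L * m]"
    proof -
      have append: "map q [b..<c] @ map q [c..<d] = map q [b..<d]" if "b \<le> c" "c \<le> d" for b c d
        using that by (metis map_append le_Suc_ex upt_add_eq_append)
      have "n - m + 1 * m = n" "n - m + N2 * m + 1 * m = n - m + Suc N2 * m"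
        "n - m + N2 * m + L * m = n - m + (N2 + L) * m"
        using \<open>m < n\<close> by (simp_all add: algebra_simps)
      moreover have "1 * m \<le> N2 * m" "N2 * m \<le> Suc N2 * m" "Suc N2 * m \<le> (N2 + L) * m"
        using N2_ge L(1) by (intro mult_le_mono1; simp)+
      ultimately show ?thesis
        by (simp only: append add_left_mono le_add2 le0 trans_le_add1 order.trans)
    qed
    ultimately show ?thesis
      by (simp only: W_def)
  qed

  \<comment> \<open>What windows of the first kind determine\<close>
  text \<open>
    Deleting one of the \<open>k + 1\<close> consecutive zero blocks of \<open>s1\<close> deletes only the window at \<open>0\<close> from
    its cycle of windows.
  \<close>
  have x_window: "x (N2 + j + c) t = s1 ((1 + j mod M) * m1 + (c * m1 + t))"
    if "c \<le> k" "t < m1" for j c t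
  proof -
    have zero: "s1 (i * m1 + t) = 0" if "i \<le> k" for i
    proof -
      have "i * m1 \<le> k * m1"
        using that by (rule mult_le_mono1)
      then have "i * m1 + t < n1"
        unfolding n1_eq add_mult_distrib using \<open>t < m1\<close> by linarith
      then show ?thesis
        by (simp add: s1_zero)
    qed
    have jM: "j mod M < M"
      using M(3) by simp
    have rhs: "(1 + j mod M) * m1 + (c * m1 + t) = (1 + j mod M + c) * m1 + t"
      by (simp add: algebra_simps)
    show ?thesis
    proof (cases "j + c < k")
      case True
      then have "j mod M = j"
        using M(2) by simp
      with True zero[of "1 + j + c"] show ?thesis
        unfolding rhs by (simp add: x_def)
    next
      case False
      define d where "d = (j + c - k) mod M"
      have "x (N2 + j + c) t = s1 ((k + 1 + d) * m1 + t)"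
        using False by (simp add: x_def d_def n1_eq algebra_simps)
      also have "\<dots> = s1 ((1 + j mod M + c) * m1 + t)"
      proof (cases "k \<le> j mod M + c")
        case True
        have "j + c - k = j mod M + c - k + j div M * M"
          using True div_mult_mod_eq[of j M] by linarith
        then have "d = (j mod M + c - k) mod M"
          by (simp add: d_def)
        also have "\<dots> = j mod M + c - k"
          using True jM that(1) by simp
        finally show ?thesis
          using True by (simp add: add.commute)
      next
        \<comment> \<open>The index has passed the deleted block, so the blocks read on the two
          sides differ by one modulo \<open>N1\<close>. Both lie among the blocks \<open>0\<close>
          to \<open>k\<close> of \<open>s1\<close>, which are zero.\<close>
        case False': False
        obtain e where e: "j div M = Suc e"
          using False False' div_mult_mod_eq[of j M] by (cases "j div M") auto
        then have "j = M + e * M + j mod M"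
          by (metis div_mult_mod_eq mult_Suc)
        then have "j + c - k = (M + j mod M + c - k) + e * M"
          using M(2) by linarith
        then have "d = (M + j mod M + c - k) mod M"
          by (simp add: d_def)
        also have "\<dots> = M + j mod M + c - k"
          using False' M(2) by simp
        finally have "k + 1 + d = (j mod M + c) + N1"
          using M by simp
        then have "s1 ((k + 1 + d) * m1 + t) = s1 ((j mod M + c) * m1 + t + m1 * N1)"
          by (simp add: algebra_simps)
        also have "\<dots> = 0"
          using False' zero s1_period by simp
        finally show ?thesis
          using False' zero[of "1 + j mod M + c"] by simp
      qed
      finally show ?thesis
        unfolding rhs .
    qed
  qed

  \<comment> \<open>In \<open>s1\<close>, windows of the zero phase start at block 0, later ones at
    block \<open>1 + (i - N2) mod M\<close>. All starts are below \<open>N1\<close>, so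
    \<open>s1_inj\<close> separates them. For \<open>i < N2\<close> the conclusion is absurd, so the
    two phases share no window.\<close>
  have x_inj: "1 + j mod M = (if i < N2 then 0 else 1 + (i - N2) mod M)"
    if eq: "\<And>c t. c \<le> k \<Longrightarrow> t < m1 \<Longrightarrow> x (N2 + j + c) t = x (i + c) t" for i j
  proof -
    let ?i = "if i < N2 then 0 else 1 + (i - N2) mod M"
    have bounds: "(j mod M) < M" "((i - N2) mod M) < M"
      using M(3) by simp_all
    have "(1 + j mod M) mod N1 = ?i mod N1"
    proof (rule s1_inj[rule_format])
      fix p assume p: "p < n1"
      define c t where "c = p div m1" and "t = p mod m1"
      have ct: "p = c * m1 + t" "t < m1" "c \<le> k"
        using p m(2) by (auto simp: c_def t_def n1_eq less_mult_imp_div_less less_Suc_eq_le[symmetric])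
      have "s1 ((1 + j mod M) * m1 + p) = x (i + c) t"
        using x_window[OF ct(3,2), of j] eq[OF ct(3,2)] by (simp add: ct(1))
      also have "\<dots> = s1 (?i * m1 + p)"
      proof (cases "i < N2")
        case True
        then show ?thesis
          using p ct(3) by (simp add: x_def s1_zero)
      next
        case False
        then show ?thesis
          using x_window[OF ct(3,2), of "i - N2"] by (simp add: ct(1))
      qed
      finally show "s1 ((1 + j mod M) * m1 + p) = s1 (?i * m1 + p)" .
    qed
    with bounds M(1) show ?thesis
      by (simp split: if_splits)
  qed

  \<comment> \<open>Counting and distinctness of the windows\<close>
  \<comment> \<open>\<open>N1 - 1\<close> is coprime to \<open>N1 = a ^ n1\<close>, hence to
    \<open>a\<close> and to each of its powers.\<close>
  have "coprime M N2"
  proof -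
    have "coprime M N1"
      using coprime_diff_one_left_nat[of N1] kN1 by (simp add: M_def)
    moreover have "n1 > 0"
      using le(1) m(2) by simp
    ultimately show ?thesis
      by (simp add: N1 N2)
  qed
  have card: "N2 + L = card A ^ n"
    unfolding L(2) by (simp add: N1 N2 a n_split power_add)
  have len: "length W = m * card A ^ n + n - m"
    using \<open>m < n\<close> by (simp add: W card mult.commute)
  have "shift_de_Bruijn m n A W"
  proof (rule shift_de_Bruijn_if_inj_on[OF \<open>finite A\<close> _ \<open>1 \<le> m\<close> _ len])
    have "q p \<in> A" for p
      using zero s1_in s2_in by (simp add: q_def x_def y_def)
    then show "set W \<subseteq> A"
      by (auto simp: W)
    have window: "take n (drop (i * m) W) = map (\<lambda>c. q (i * m + c)) [0..<n]" if "i < N2 + L" for i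
    proof -
      have "Suc i * m \<le> (N2 + L) * m"
        using that by (intro mult_le_mono1) simp
      then show ?thesis
        unfolding W using \<open>m < n\<close> by (intro take_drop_map_upt) simp
    qed
    show "inj_on (\<lambda>i. take n (drop (i * m) W)) {..<card A ^ n}"
      unfolding card[symmetric]
    proof (rule inj_onI)
      fix i j
      assume ij: "i \<in> {..<N2 + L}" "j \<in> {..<N2 + L}"
        and "take n (drop (i * m) W) = take n (drop (j * m) W)"
      then have "map (\<lambda>c. q (i * m + c)) [0..<n] = map (\<lambda>c. q (j * m + c)) [0..<n]"
        by (simp add: window)
      then have q_eq: "q (i * m + c) = q (j * m + c)" if "c < n" for c
        using that by (simp add: list_eq_iff_nth_eq)
      have x_eq: "x (i + c) t = x (j + c) t" if "c \<le> k" "t < m1" for c t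
      proof -
        have "c * m \<le> k * m"
          using that(1) by (rule mult_le_mono1)
        then have "c * m + t < n"
          using that(2) n_eq by linarith
        from q_eq[OF this] show ?thesis
          using that(2) by (simp add: q_x add.assoc[symmetric] add_mult_distrib[symmetric])
      qed
      have y_eq: "y (i + c) t = y (j + c) t" if "c < k" "t < m2" for c t
      proof -
        have "Suc c * m \<le> k * m"
          using that(1) by (intro mult_le_mono1) simp
        then have "c * m + m1 + t < n"
          using that(2) m(1) n_eq unfolding mult_Suc by linarith
        from q_eq[OF this] show ?thesis
          using that(2) by (simp add: q_y add.assoc[symmetric] add_mult_distrib[symmetric])
      qed
      have mod_N2: "i mod N2 = j mod N2"
      proof (rule s2_inj[rule_format])
        fix p assume p: "p < n2"
        have ct: "p div m2 < k" "p mod m2 < m2"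
          using p m(3) by (simp_all add: n2_eq less_mult_imp_div_less)
        have "h * m2 + p = (h + p div m2) * m2 + p mod m2" for h
          by (simp add: add_mult_distrib)
        then show "s2 (i * m2 + p) = s2 (j * m2 + p)"
          using y_eq[OF ct] by (simp add: y_def)
      qed
      show "i = j"
      proof (cases "i < N2 \<and> j < N2")
        case True
        with mod_N2 show ?thesis
          by simp
      next
        case False
        \<comment> \<open>If one index is past the zero phase, \<open>x_inj\<close> forces the other
          past it too; both orders are needed.\<close>
        have ge: "N2 \<le> i" "N2 \<le> j"
          using False x_inj[of "i - N2" j] x_inj[of "j - N2" i] x_eq
          by (auto split: if_splits)
        then have "(i - N2) mod M = (j - N2) mod M"
          using x_inj[of "i - N2" j] x_eq by simp
        moreover have "(i - N2) mod N2 = (j - N2) mod N2"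
          using mod_N2 ge by (metis le_mod_geq)
        \<comment> \<open>Both differences are below \<open>L = M * N2\<close>, so agreement modulo
          \<open>L\<close> is equality.\<close>
        ultimately have "(i - N2) mod L = (j - N2) mod L"
          unfolding L_def by (rule mod_mult_eqI[OF \<open>coprime M N2\<close>])
        then show ?thesis
          using ij ge by simp
      qed
    qed
  qed (use zero in auto)
  then show ?thesis
    by (simp only: W_def L_def M_def)
qed

end
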